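(* The following assertions hold. (a) The set $\operatorname{gph}\overline\Psi$ is closed. (b) Whenever $\operatorname{gph}\Phi_{\mathrm w}$ is closed, the inclusions $\operatorname{gph}\Psi\subset\operatorname{gph}\overline\Psi\subset\operatorname{gph}\Psi_{\mathrm w}$ hold. Particularly, $\Psi(x)\subset\overline\Psi(x)\subset\Psi_{\mathrm w}(x)$ is valid for each $x\in\mathbb R^n$ in this situation. (c) We have $\operatorname{cl}\operatorname{gph}\Psi\subset\operatorname{gph}\overline\Psi$.
   Context: Setting: $f\colon\mathbb R^n\times\mathbb R^m\to\mathbb R^q$ is continuous, $\mathcal C\subset\mathbb R^q$ is a nonempty, closed, convex, pointed cone with nonempty interior, and $\Gamma\colon\mathbb R^n\rightrightarrows\mathbb R^m$ is a set-valued mapping (values may be empty) with closed graph. For $x\in\mathbb R^n$ let $f(x,A):=\{f(x,y)\mid y\in A\}$ for $A\subset\mathbb R^m$, and define $\Psi(x):=\{y\in\Gamma(x)\mid (\{f(x,y)\}-\mathcal C\setminus\{0\})\cap f(x,\Gamma(x))=\emptyset\}$, $\Psi_{\mathrm w}(x):=\{y\in\Gamma(x)\mid (\{f(x,y)\}-\operatorname{int}\mathcal C)\cap f(x,\Gamma(x))=\emptyset\}$, $\Phi(x):=f(x,\Psi(x))$, $\Phi_{\mathrm w}(x):=f(x,\Psi_{\mathrm w}(x))$. The mapping $\overline\Phi\colon\mathbb R^n\rightrightarrows\mathbb R^q$ is defined by $\operatorname{gph}\overline\Phi:=\operatorname{cl}\operatorname{gph}\Phi$, and $\overline\Psi\colon\mathbb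 R^n\rightrightarrows\mathbb R^m$ by $\overline\Psi(x):=\{y\in\Gamma(x)\mid f(x,y)\in\overline\Phi(x)\}$ for all $x\in\mathbb R^n$. Here $\operatorname{gph}\Upsilon:=\{(x,y)\mid y\in\Upsilon(x)\}$ for a set-valued mapping $\Upsilon$, and $\operatorname{cl}$ denotes closure. *)

theory Defs
  imports "HOL-Analysis.Analysis"
begin

text \<open>A set-valued mapping is a function into sets; its values may be empty.\<close>

definition gph :: "('a \<Rightarrow> 'b set) \<Rightarrow> ('a \<times> 'b) set" where
  "gph \<Upsilon> = {(x, y). y \<in> \<Upsilon> x}"

definition pointed :: "'a::real_vector set \<Rightarrow> bool" where
  "pointed C \<longleftrightarrow> C \<inter> uminus ` C = {0}"

text \<open>The parametric problem has parameter \<open>x\<close>, decision variable \<open>y\<close>, objective \<open>f\<close>,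
  ordering cone \<open>C\<close> and feasible sets \<open>\<Gamma> x\<close>. In \<open>eff_sol\<close> and \<open>weff_sol\<close>, the image of a
  set \<open>D\<close> under \<open>c \<mapsto> f (x, y) - c\<close> is the Minkowski difference of \<open>{f (x, y)}\<close> and \<open>D\<close>.\<close>

definition eff_sol ::
  "('a \<times> 'b \<Rightarrow> 'c::real_vector) \<Rightarrow> 'c set \<Rightarrow> ('a \<Rightarrow> 'b set) \<Rightarrow> 'a \<Rightarrow> 'b set" where
  "eff_sol f C \<Gamma> x =
    {y \<in> \<Gamma> x. (\<lambda>c. f (x, y) - c) ` (C - {0}) \<inter> (\<lambda>y'. f (x, y')) ` \<Gamma> x = {}}"

definition weff_sol ::
  "('a \<times> 'b \<Rightarrow> 'c::real_normed_vector) \<Rightarrow> 'c set \<Rightarrow> ('a \<Rightarrow> 'b set) \<Rightarrow> 'a \<Rightarrow> 'b set" where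
  "weff_sol f C \<Gamma> x =
    {y \<in> \<Gamma> x. (\<lambda>c. f (x, y) - c) ` interior C \<inter> (\<lambda>y'. f (x, y')) ` \<Gamma> x = {}}"

definition eff_val ::
  "('a \<times> 'b \<Rightarrow> 'c::real_vector) \<Rightarrow> 'c set \<Rightarrow> ('a \<Rightarrow> 'b set) \<Rightarrow> 'a \<Rightarrow> 'c set" where
  "eff_val f C \<Gamma> x = (\<lambda>y. f (x, y)) ` eff_sol f C \<Gamma> x"

definition weff_val ::
  "('a \<times> 'b \<Rightarrow> 'c::real_normed_vector) \<Rightarrow> 'c set \<Rightarrow> ('a \<Rightarrow> 'b set) \<Rightarrow> 'a \<Rightarrow> 'c set" where
  "weff_val f C \<Gamma> x = (\<lambda>y. f (x, y)) ` weff_sol f C \<Gamma> x"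

definition eff_val_closure ::
  "('a::topological_space \<times> 'b \<Rightarrow> 'c::real_normed_vector) \<Rightarrow> 'c set \<Rightarrow> ('a \<Rightarrow> 'b set) \<Rightarrow> 'a \<Rightarrow> 'c set" where
  "eff_val_closure f C \<Gamma> x = {z. (x, z) \<in> closure (gph (eff_val f C \<Gamma>))}"

lemma gph_eff_val_closure: "gph (eff_val_closure f C \<Gamma>) = closure (gph (eff_val f C \<Gamma>))"
  by (auto simp: gph_def eff_val_closure_def)

definition eff_sol_closure ::
  "('a::topological_space \<times> 'b \<Rightarrow> 'c::real_normed_vector) \<Rightarrow> 'c set \<Rightarrow> ('a \<Rightarrow> 'b set) \<Rightarrow> 'a \<Rightarrow> 'b set" where
  "eff_sol_closure f C \<Gamma> x = {y \<in> \<Gamma> x. f (x, y) \<in> eff_val_closure f C \<Gamma> x}"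

end

theory Submission
  imports Defs
begin

text \<open>The graph of \<open>eff_sol_closure\<close> is the part of \<open>gph \<Gamma>\<close> that the continuous map
  \<open>(x, y) \<mapsto> (x, f (x, y))\<close> sends into the closure of \<open>gph (eff_val f C \<Gamma>)\<close>; this gives (a),
  and (c) follows since it contains \<open>gph (eff_sol f C \<Gamma>)\<close>. Pointedness keeps \<open>0\<close> out of the
  interior of \<open>C\<close>, so efficient values are weakly efficient; and whether a feasible \<open>y\<close> is
  weakly efficient depends only on \<open>f (x, y)\<close>, which gives (b).\<close>

text \<open>A ball around 0 inside \<open>C\<close> would contain a nonzero vector together with its
  negative.\<close>

lemma pointed_imp_zero_notin_interior:
  fixes C :: "'a::euclidean_space set"
  assumes "pointed C"
  shows "0 \<notin> interior C"
proof
  assume "0 \<in> interior C"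
  then obtain e where e: "e > 0" "ball 0 e \<subseteq> C"
    by (auto simp: mem_interior)
  \<comment> \<open>Positive dimension enters here: in a zero-dimensional space \<open>{0}\<close>
    is pointed and open.\<close>
  obtain b :: 'a where b: "b \<in> Basis"
    using nonempty_Basis by blast
  define v where "v = (e / 2) *\<^sub>R b"
  have "norm v < e"
    using e(1) b by (simp add: v_def)
  then have "v \<in> C" "- v \<in> C"
    using e(2) by auto
  then have "v \<in> C \<inter> uminus ` C"
    by (auto intro: image_eqI[where x = "- v"])
  with assms have "v = 0"
    by (auto simp: pointed_def)
  moreover have "v \<noteq> 0"
    using e(1) b by (auto simp: v_def)
  ultimately show False by simp
qed

text \<open>Weak efficiency forbids fewer directions of improvement.\<close>

lemma eff_sol_subset_weff_sol:
  assumes "0 \<notin> interior C"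
  shows "eff_sol f C \<Gamma> x \<subseteq> weff_sol f C \<Gamma> x"
proof -
  have "interior C \<subseteq> C - {0}"
    using assms interior_subset by blast
  then show ?thesis
    unfolding eff_sol_def weff_sol_def by blast
qed

text \<open>The hypothesis only provides some weakly efficient \<open>y'\<close> with
  \<open>f (x, y') = f (x, y)\<close>; the condition on \<open>y'\<close> sees nothing but this
  common value, so it passes to \<open>y\<close>.\<close>

lemma weff_sol_cong_val:
  assumes "y \<in> \<Gamma> x" and "f (x, y) \<in> weff_val f C \<Gamma> x"
  shows "y \<in> weff_sol f C \<Gamma> x"
  using assms by (auto simp: weff_val_def weff_sol_def)

lemma gph_mono_iff: "gph F \<subseteq> gph G \<longleftrightarrow> (\<forall>x. F x \<subseteq> G x)"
  by (auto simp: gph_def)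

lemma gph_eff_sol_closure:
  "gph (eff_sol_closure f C \<Gamma>) =
    gph \<Gamma> \<inter> (\<lambda>p. (fst p, f p)) -` closure (gph (eff_val f C \<Gamma>))"
  by (auto simp: gph_def eff_sol_closure_def eff_val_closure_def)

lemma closed_gph_eff_sol_closure:
  assumes "continuous_on UNIV f" and "closed (gph \<Gamma>)"
  shows "closed (gph (eff_sol_closure f C \<Gamma>))"
  unfolding gph_eff_sol_closure
  by (intro closed_Int assms closed_vimage closed_closure continuous_intros)

lemma eff_sol_subset_eff_sol_closure: "eff_sol f C \<Gamma> x \<subseteq> eff_sol_closure f C \<Gamma> x"
proof
  fix y assume y: "y \<in> eff_sol f C \<Gamma> x"
  then have "(x, f (x, y)) \<in> gph (eff_val f C \<Gamma>)"
    by (auto simp: gph_def eff_val_def)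
  then have "(x, f (x, y)) \<in> closure (gph (eff_val f C \<Gamma>))"
    using closure_subset by blast
  with y show "y \<in> eff_sol_closure f C \<Gamma> x"
    by (simp add: eff_sol_closure_def eff_val_closure_def eff_sol_def)
qed

lemma eff_sol_closure_subset_weff_sol:
  assumes "0 \<notin> interior C" and "closed (gph (weff_val f C \<Gamma>))"
  shows "eff_sol_closure f C \<Gamma> x \<subseteq> weff_sol f C \<Gamma> x"
proof
  fix y assume y: "y \<in> eff_sol_closure f C \<Gamma> x"
  have "gph (eff_val f C \<Gamma>) \<subseteq> gph (weff_val f C \<Gamma>)"
    unfolding gph_mono_iff eff_val_def weff_val_def
    by (intro allI image_mono eff_sol_subset_weff_sol assms(1))
  \<comment> \<open>Closedness of the weak value graph lets it absorb the limits of efficient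
    values.\<close>
  then have "closure (gph (eff_val f C \<Gamma>)) \<subseteq> gph (weff_val f C \<Gamma>)"
    using assms(2) by (rule closure_minimal)
  with y show "y \<in> weff_sol f C \<Gamma> x"
    by (intro weff_sol_cong_val) (auto simp: eff_sol_closure_def eff_val_closure_def gph_def)
qed

theorem lemma3p18:
  fixes f :: "(real ^ 'n) \<times> (real ^ 'm) \<Rightarrow> real ^ 'q"
    and C :: "(real ^ 'q) set"
    and \<Gamma> :: "real ^ 'n \<Rightarrow> (real ^ 'm) set"
  assumes "continuous_on UNIV f"
    and "C \<noteq> {}" and "closed C" and "convex C" and "cone C" and "pointed C"
    and "interior C \<noteq> {}"
    and "closed (gph \<Gamma>)"
  shows "closed (gph (eff_sol_closure f C \<Gamma>))
    \<and> (closed (gph (weff_val f C \<Gamma>)) \<longrightarrow>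
        gph (eff_sol f C \<Gamma>) \<subseteq> gph (eff_sol_closure f C \<Gamma>)
        \<and> gph (eff_sol_closure f C \<Gamma>) \<subseteq> gph (weff_sol f C \<Gamma>)
        \<and> (\<forall>x. eff_sol f C \<Gamma> x \<subseteq> eff_sol_closure f C \<Gamma> x
             \<and> eff_sol_closure f C \<Gamma> x \<subseteq> weff_sol f C \<Gamma> x))
    \<and> closure (gph (eff_sol f C \<Gamma>)) \<subseteq> gph (eff_sol_closure f C \<Gamma>)"
proof -
  have sub: "gph (eff_sol f C \<Gamma>) \<subseteq> gph (eff_sol_closure f C \<Gamma>)"
    by (simp add: gph_mono_iff eff_sol_subset_eff_sol_closure)
  have cl: "closed (gph (eff_sol_closure f C \<Gamma>))"
    using assms(1,8) by (rule closed_gph_eff_sol_closure)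
  have weff: "eff_sol_closure f C \<Gamma> x \<subseteq> weff_sol f C \<Gamma> x"
    if "closed (gph (weff_val f C \<Gamma>))" for x
    using pointed_imp_zero_notin_interior[OF assms(6)] that
    by (rule eff_sol_closure_subset_weff_sol)
  \<comment> \<open>Assertion (c) is minimality of the closure, applied to the closed superset from
    \<open>cl\<close> and \<open>sub\<close>.\<close>
  show ?thesis
    using cl sub closure_minimal[OF sub cl] weff unfolding gph_mono_iff by blast
qed

end
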